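(* Let $p$ be an odd prime. Any matrix $\begin{bmatrix} A & B \\ C & D \end{bmatrix}$ in $M_2(\mathbb{Z}_p)$ is a square or a sum of two squares of matrices in $M_2(\mathbb{Z}_p)$.
   Context: $\mathbb{Z}_p$ is the ring of $p$-adic integers and $M_2(\mathbb{Z}_p)$ is the ring of $2 \times 2$ matrices over $\mathbb{Z}_p$. *)

theory Defs
  imports
    "HOL-Algebra.Ring"
    "HOL-Analysis.Finite_Cartesian_Product"
    "HOL-Computational_Algebra.Primes"
begin

text \<open>
  The ring \<open>\<int>\<^sub>p\<close> as the inverse limit of the rings \<open>\<int>/p\<^sup>n\<int>\<close>: an element is a
  sequence whose \<open>n\<close>-th term is the canonical representative in \<open>{0..<p\<^sup>n}\<close> of its
  residue modulo \<open>p\<^sup>n\<close>, successive terms being compatible under reduction. Reducing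
  the constant \<open>1\<close> matters only at \<open>n = 0\<close>, where \<open>p\<^sup>0 = 1\<close>.
\<close>

definition padic_int :: "nat \<Rightarrow> (nat \<Rightarrow> int) ring" where
  "padic_int p =
    \<lparr>carrier = {x. \<forall>n. x n \<in> {0..<int p ^ n} \<and> x (Suc n) mod int p ^ n = x n},
     monoid.mult = (\<lambda>x y n. (x n * y n) mod int p ^ n),
     one = (\<lambda>n. 1 mod int p ^ n),
     zero = (\<lambda>n. 0),
     add = (\<lambda>x y n. (x n + y n) mod int p ^ n)\<rparr>"

text \<open>
  The full matrix ring over a ring given by a record. The operations of
  \<open>HOL-Analysis\<close> on \<open>'a ^ 'n ^ 'n\<close> do not apply here, since they use the type class
  structure on the type of entries instead of the operations of \<open>R\<close>.
\<close>

definition mat_ring :: "('a, 'b) ring_scheme \<Rightarrow> ('a ^ 'n ^ 'n) ring" where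
  "mat_ring R =
    \<lparr>carrier = {M. \<forall>i j. M $ i $ j \<in> carrier R},
     monoid.mult = (\<lambda>M N. \<chi> i j. \<Oplus>\<^bsub>R\<^esub>k\<in>UNIV. M $ i $ k \<otimes>\<^bsub>R\<^esub> N $ k $ j),
     one = (\<chi> i j. if i = j then \<one>\<^bsub>R\<^esub> else \<zero>\<^bsub>R\<^esub>),
     zero = (\<chi> i j. \<zero>\<^bsub>R\<^esub>),
     add = (\<lambda>M N. \<chi> i j. M $ i $ j \<oplus>\<^bsub>R\<^esub> N $ i $ j)\<rparr>"

lemma cring_padic_int:
  assumes "p > 0"
  shows "cring (padic_int p)"
proof -
  have pos: "int p ^ n > 0" for n
    using assms by simp
  have red: "(a mod int p ^ Suc n) mod int p ^ n = a mod int p ^ n" for a n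
    by (rule mod_mod_cancel) simp
  have coh_add: "((a + b) mod int p ^ Suc n) mod int p ^ n
      = (a mod int p ^ n + b mod int p ^ n) mod int p ^ n" for a b n
    unfolding red by (simp add: mod_add_eq)
  have coh_mult: "((a * b) mod int p ^ Suc n) mod int p ^ n
      = ((a mod int p ^ n) * (b mod int p ^ n)) mod int p ^ n" for a b n
    unfolding red by (simp add: mod_mult_eq)
  let ?neg = "\<lambda>x n. (- x n) mod int p ^ n"
  have neg: "?neg x \<in> carrier (padic_int p)" "?neg x \<oplus>\<^bsub>padic_int p\<^esub> x = \<zero>\<^bsub>padic_int p\<^esub>"
    if x: "x \<in> carrier (padic_int p)" for x
  proof -
    have "((- x (Suc n)) mod int p ^ Suc n) mod int p ^ n = (- x n) mod int p ^ n" for n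
    proof -
      have "x (Suc n) mod int p ^ n = x n"
        using x by (simp add: padic_int_def)
      then show ?thesis
        unfolding red by (metis mod_minus_eq)
    qed
    then show "?neg x \<in> carrier (padic_int p)"
      using pos by (simp add: padic_int_def)
    show "?neg x \<oplus>\<^bsub>padic_int p\<^esub> x = \<zero>\<^bsub>padic_int p\<^esub>"
      by (simp add: padic_int_def fun_eq_iff mod_simps)
  qed
  show ?thesis
  proof (rule cringI)
    show "abelian_group (padic_int p)"
    proof (rule abelian_groupI)
      show "\<exists>y\<in>carrier (padic_int p). y \<oplus>\<^bsub>padic_int p\<^esub> x = \<zero>\<^bsub>padic_int p\<^esub>"
        if "x \<in> carrier (padic_int p)" for x
        using neg[OF that] by blast
    qed (use pos in \<open>auto simp: padic_int_def fun_eq_iff coh_add mod_simps add_ac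
          simp del: power_Suc\<close>)
    show "comm_monoid (padic_int p)"
    proof (rule comm_monoidI)
      show "x \<otimes>\<^bsub>padic_int p\<^esub> y \<in> carrier (padic_int p)"
        if "x \<in> carrier (padic_int p)" "y \<in> carrier (padic_int p)" for x y
        using that pos by (simp add: padic_int_def coh_mult del: power_Suc)
      show "\<one>\<^bsub>padic_int p\<^esub> \<in> carrier (padic_int p)"
        using pos by (simp add: padic_int_def red del: power_Suc)
    qed (auto simp: padic_int_def fun_eq_iff mod_simps mult_ac)
  qed (auto simp: padic_int_def fun_eq_iff mod_simps distrib_right)
qed

lemma ring_mat_ring:
  assumes "ring R"
  shows "ring (mat_ring R :: ('a ^ 'n ^ 'n) ring)"
proof -
  interpret R: ring R by (rule assms)
  let ?M = "mat_ring R :: ('a ^ 'n ^ 'n) ring"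
  have delta_l: "(\<Oplus>\<^bsub>R\<^esub>k\<in>(UNIV::'n set). (if i = k then \<one>\<^bsub>R\<^esub> else \<zero>\<^bsub>R\<^esub>) \<otimes>\<^bsub>R\<^esub> f k) = f i"
    if f: "\<And>k. f k \<in> carrier R" for f i
  proof -
    have "(\<Oplus>\<^bsub>R\<^esub>k\<in>(UNIV::'n set). (if i = k then \<one>\<^bsub>R\<^esub> else \<zero>\<^bsub>R\<^esub>) \<otimes>\<^bsub>R\<^esub> f k)
        = (\<Oplus>\<^bsub>R\<^esub>k\<in>UNIV. if i = k then f k else \<zero>\<^bsub>R\<^esub>)"
      by (rule R.finsum_cong') (auto simp: f)
    then show ?thesis
      using R.finsum_singleton[of i "UNIV::'n set" f] f by auto
  qed
  have delta_r: "(\<Oplus>\<^bsub>R\<^esub>k\<in>(UNIV::'n set). f k \<otimes>\<^bsub>R\<^esub> (if k = j then \<one>\<^bsub>R\<^esub> else \<zero>\<^bsub>R\<^esub>)) = f j"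
    if f: "\<And>k. f k \<in> carrier R" for f j
  proof -
    have "(\<Oplus>\<^bsub>R\<^esub>k\<in>(UNIV::'n set). f k \<otimes>\<^bsub>R\<^esub> (if k = j then \<one>\<^bsub>R\<^esub> else \<zero>\<^bsub>R\<^esub>))
        = (\<Oplus>\<^bsub>R\<^esub>k\<in>UNIV. if j = k then f k else \<zero>\<^bsub>R\<^esub>)"
      by (rule R.finsum_cong') (auto simp: f)
    then show ?thesis
      using R.finsum_singleton[of j "UNIV::'n set" f] f by auto
  qed
  have swap: "(\<Oplus>\<^bsub>R\<^esub>k\<in>A. \<Oplus>\<^bsub>R\<^esub>l\<in>(UNIV::'n set). f k l) = (\<Oplus>\<^bsub>R\<^esub>l\<in>UNIV. \<Oplus>\<^bsub>R\<^esub>k\<in>A. f k l)"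
    if f: "\<And>k l. f k l \<in> carrier R" and "finite A" for f and A :: "'n set"
    using \<open>finite A\<close>
    by (induction A rule: finite_induct) (simp_all add: f R.finsum_addf Pi_def)
  have assoc: "(\<Oplus>\<^bsub>R\<^esub>k\<in>(UNIV::'n set). (\<Oplus>\<^bsub>R\<^esub>l\<in>(UNIV::'n set). x l \<otimes>\<^bsub>R\<^esub> y l k) \<otimes>\<^bsub>R\<^esub> z k)
      = (\<Oplus>\<^bsub>R\<^esub>l\<in>UNIV. x l \<otimes>\<^bsub>R\<^esub> (\<Oplus>\<^bsub>R\<^esub>k\<in>UNIV. y l k \<otimes>\<^bsub>R\<^esub> z k))"
    if [simp]: "\<And>l. x l \<in> carrier R" "\<And>l k. y l k \<in> carrier R" "\<And>k. z k \<in> carrier R" for x y z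
    by (simp add: R.finsum_ldistr R.finsum_rdistr Pi_def R.m_assoc) (rule swap; simp)
  show ?thesis
  proof (rule ringI)
    show "abelian_group ?M"
    proof (rule abelian_groupI)
      show "\<exists>y\<in>carrier ?M. y \<oplus>\<^bsub>?M\<^esub> x = \<zero>\<^bsub>?M\<^esub>" if "x \<in> carrier ?M" for x
        by (rule bexI[of _ "\<chi> i j. \<ominus>\<^bsub>R\<^esub> (x $ i $ j)"])
          (use that in \<open>auto simp: mat_ring_def vec_eq_iff R.l_neg\<close>)
    qed (auto simp: mat_ring_def vec_eq_iff R.a_ac)
    show "monoid ?M"
      by (rule monoidI)
        (auto simp: mat_ring_def vec_eq_iff assoc delta_l delta_r intro!: R.finsum_closed)
  qed (auto simp: mat_ring_def vec_eq_iff R.l_distr R.r_distr Pi_def R.finsum_addf)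
qed

end

theory Submission
  imports Defs "HOL-Analysis.Cartesian_Space"
begin

text \<open>
  Over a commutative ring in which \<open>2\<close> has an inverse \<open>h\<close>, the matrix
  \<open>X = M + h (1 - tr M) I\<close> has trace \<open>1\<close>, so \<open>X\<^sup>2 = X - det X \<cdot> I\<close> by Cayley-Hamilton and
  \<open>M - X\<^sup>2\<close> is a scalar matrix \<open>s I\<close>. Every scalar matrix is a square, namely that of the
  matrix with zero diagonal and off-diagonal entries \<open>s\<close> and \<open>1\<close>.
\<close>

definition mat2 :: "'a \<Rightarrow> 'a \<Rightarrow> 'a \<Rightarrow> 'a \<Rightarrow> 'a ^ 2 ^ 2" where
  "mat2 a b c d = (\<chi> i j. if i = 1 then if j = 1 then a else b else if j = 1 then c else d)"

lemma mat2_nth [simp]: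
  "mat2 a b c d $ 1 $ 1 = a" "mat2 a b c d $ 1 $ 2 = b"
  "mat2 a b c d $ 2 $ 1 = c" "mat2 a b c d $ 2 $ 2 = d"
  by (simp_all add: mat2_def)

lemma mat2_eta: "mat2 (M $ 1 $ 1) (M $ 1 $ 2) (M $ 2 $ 1) (M $ 2 $ 2) = M"
  by (simp add: vec_eq_iff forall_2)

lemma mat2_in_carrier [simp]:
  "mat2 a b c d \<in> carrier (mat_ring R) \<longleftrightarrow>
    a \<in> carrier R \<and> b \<in> carrier R \<and> c \<in> carrier R \<and> d \<in> carrier R"
  by (auto simp: mat_ring_def forall_2)

lemma mat2_add:
  "mat2 a b c d \<oplus>\<^bsub>mat_ring R\<^esub> mat2 a' b' c' d' =
    mat2 (a \<oplus>\<^bsub>R\<^esub> a') (b \<oplus>\<^bsub>R\<^esub> b') (c \<oplus>\<^bsub>R\<^esub> c') (d \<oplus>\<^bsub>R\<^esub> d')"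
  by (simp add: mat_ring_def vec_eq_iff forall_2)

context cring
begin

text \<open>Unlike for addition, carrier assumptions enter: an entry of the product is a
  \<open>finsum\<close> over the two indices, and the rules unfolding it into two terms ask for
  summands in the carrier.\<close>

lemma mat2_mult:
  assumes "a \<in> carrier R" "b \<in> carrier R" "c \<in> carrier R" "d \<in> carrier R"
    and "a' \<in> carrier R" "b' \<in> carrier R" "c' \<in> carrier R" "d' \<in> carrier R"
  shows "mat2 a b c d \<otimes>\<^bsub>mat_ring R\<^esub> mat2 a' b' c' d' =
    mat2 (a \<otimes> a' \<oplus> b \<otimes> c') (a \<otimes> b' \<oplus> b \<otimes> d') (c \<otimes> a' \<oplus> d \<otimes> c') (c \<otimes> b' \<oplus> d \<otimes> d')"
  using assms by (simp add: mat_ring_def vec_eq_iff forall_2 UNIV_2)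

lemma mat2_sum_of_two_squares:
  assumes h: "h \<in> carrier R" "h \<oplus> h = \<one>"
    and M: "M \<in> carrier (mat_ring R :: ('a ^ 2 ^ 2) ring)"
  shows "\<exists>X \<in> carrier (mat_ring R). \<exists>Y \<in> carrier (mat_ring R).
    M = (X \<otimes>\<^bsub>mat_ring R\<^esub> X) \<oplus>\<^bsub>mat_ring R\<^esub> (Y \<otimes>\<^bsub>mat_ring R\<^esub> Y)"
proof -
  obtain A B C D where M_eq: "M = mat2 A B C D"
    by (metis mat2_eta)
  have [simp]: "A \<in> carrier R" "B \<in> carrier R" "C \<in> carrier R" "D \<in> carrier R" "h \<in> carrier R"
    using M h by (simp_all add: M_eq)
  \<comment> \<open>\<open>a\<close> and \<open>d\<close> are the diagonal entries of X: since A =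
    2hA, the entry A + h(1 - A - D) becomes h + h(A - D), and likewise for D. They solve a + d = 1,
    a - d = A - D.\<close>
  define e where "e = h \<otimes> (A \<ominus> D)"
  define a where "a = h \<oplus> e"
  define d where "d = h \<ominus> e"
  \<comment> \<open>Forced by the upper left entry of M = X^2 + sI; that the same \<open>s\<close>
    fits the lower right entry is shown in \<open>D_eq\<close>.\<close>
  define s where "s = A \<ominus> (a \<otimes> a \<oplus> B \<otimes> C)"
  have [simp]: "e \<in> carrier R" "a \<in> carrier R" "d \<in> carrier R" "s \<in> carrier R"
    by (simp_all add: e_def a_def d_def s_def)
  have "a \<oplus> d = h \<oplus> h"
    unfolding a_def d_def using \<open>h \<in> carrier R\<close> \<open>e \<in> carrier R\<close> by algebra
  then have trace: "a \<oplus> d = \<one>"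
    by (simp add: h)
  have "a \<ominus> d = (h \<oplus> h) \<otimes> (A \<ominus> D)"
    unfolding a_def d_def e_def
    using \<open>h \<in> carrier R\<close> \<open>A \<in> carrier R\<close> \<open>D \<in> carrier R\<close> by algebra
  then have diff: "a \<ominus> d = A \<ominus> D"
    by (simp add: h)
  \<comment> \<open>Trace 1 makes the squares of \<open>a\<close> and \<open>d\<close> differ by
    exactly A - D, so one scalar corrects both diagonal entries.\<close>
  have "a \<otimes> a \<ominus> d \<otimes> d = (a \<oplus> d) \<otimes> (a \<ominus> d)"
    using \<open>a \<in> carrier R\<close> \<open>d \<in> carrier R\<close> by algebra
  then have sq_diff: "a \<otimes> a \<ominus> d \<otimes> d = A \<ominus> D"
    by (simp add: trace diff)
  have A_eq: "a \<otimes> a \<oplus> B \<otimes> C \<oplus> s = A"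
    unfolding s_def
    using \<open>a \<in> carrier R\<close> \<open>A \<in> carrier R\<close> \<open>B \<in> carrier R\<close> \<open>C \<in> carrier R\<close> by algebra
  have "C \<otimes> B \<oplus> d \<otimes> d \<oplus> s = A \<ominus> (a \<otimes> a \<ominus> d \<otimes> d)"
    unfolding s_def
    using \<open>a \<in> carrier R\<close> \<open>d \<in> carrier R\<close> \<open>A \<in> carrier R\<close> \<open>B \<in> carrier R\<close> \<open>C \<in> carrier R\<close>
    by algebra
  also have "\<dots> = D"
    unfolding sq_diff by (simp add: minus_eq minus_add r_neg2)
  finally have D_eq: "C \<otimes> B \<oplus> d \<otimes> d \<oplus> s = D" .
  \<comment> \<open>The off-diagonal entries of X^2 are those of X times the trace, so trace 1
    leaves B and C unchanged.\<close>
  have B_eq: "a \<otimes> B \<oplus> B \<otimes> d = B"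
    using trace by (simp add: m_comm[of B d] flip: l_distr)
  have C_eq: "C \<otimes> a \<oplus> d \<otimes> C = C"
    using trace by (simp add: m_comm[of d C] flip: r_distr)
  show ?thesis
  proof (intro bexI)
    show "M = (mat2 a B C d \<otimes>\<^bsub>mat_ring R\<^esub> mat2 a B C d) \<oplus>\<^bsub>mat_ring R\<^esub>
        (mat2 \<zero> s \<one> \<zero> \<otimes>\<^bsub>mat_ring R\<^esub> mat2 \<zero> s \<one> \<zero>)"
      by (simp add: M_eq mat2_mult mat2_add A_eq B_eq C_eq D_eq)
  qed simp_all
qed

end

text \<open>As p^n is odd, (p^n + 1)/2 is an integer and inverts 2 modulo p^n. The outer
  \<open>mod\<close> in the witness matters where p^n = 1, in particular at n = 0, where the entry
  must be 0.\<close>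

lemma padic_int_half:
  assumes "odd p"
  obtains h where "h \<in> carrier (padic_int p)" "h \<oplus>\<^bsub>padic_int p\<^esub> h = \<one>\<^bsub>padic_int p\<^esub>"
proof
  let ?h = "\<lambda>n. ((int p ^ n + 1) div 2) mod int p ^ n"
  have "p > 0"
    using assms by (cases p) auto
  have "((int p ^ Suc n + 1) div 2) mod int p ^ n = ((int p ^ n + 1) div 2) mod int p ^ n" for n
  proof -
    obtain k where k: "int p = 2 * k + 1"
      using assms by (metis even_of_nat oddE)
    \<comment> \<open>With p = 2k + 1, p^(n+1) = p^n + 2 k p^n, so consecutive halves differ by a
      multiple of p^n, which is the compatibility required.\<close>
    have "(int p ^ Suc n + 1) div 2 = ((int p ^ n + 1) + 2 * (int p ^ n * k)) div 2"
      unfolding power_Suc by (subst k) (simp add: algebra_simps)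
    also have "\<dots> = (int p ^ n + 1) div 2 + int p ^ n * k"
      by simp
    finally show ?thesis
      by simp
  qed
  then show "?h \<in> carrier (padic_int p)"
    using \<open>p > 0\<close> by (simp add: padic_int_def mod_mod_cancel le_imp_power_dvd del: power_Suc)
  have "2 * ((int p ^ n + 1) div 2) = int p ^ n + 1" for n
    by (rule dvd_mult_div_cancel) (simp add: assms)
  then have "(2 * ((int p ^ n + 1) div 2)) mod int p ^ n = 1 mod int p ^ n" for n
    by simp
  then show "?h \<oplus>\<^bsub>padic_int p\<^esub> ?h = \<one>\<^bsub>padic_int p\<^esub>"
    by (simp add: padic_int_def fun_eq_iff mod_mult_right_eq)
qed

theorem corollary2p4:
  fixes p :: nat
    and M :: "(nat \<Rightarrow> int) ^ 2 ^ 2"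
  assumes "prime p" and "odd p"
    and "M \<in> carrier (mat_ring (padic_int p))"
  shows "(\<exists>X \<in> carrier (mat_ring (padic_int p)).
            M = X \<otimes>\<^bsub>mat_ring (padic_int p)\<^esub> X) \<or>
         (\<exists>X \<in> carrier (mat_ring (padic_int p)). \<exists>Y \<in> carrier (mat_ring (padic_int p)).
            M = (X \<otimes>\<^bsub>mat_ring (padic_int p)\<^esub> X)
                  \<oplus>\<^bsub>mat_ring (padic_int p)\<^esub> (Y \<otimes>\<^bsub>mat_ring (padic_int p)\<^esub> Y))"
proof -
  obtain h where "h \<in> carrier (padic_int p)" "h \<oplus>\<^bsub>padic_int p\<^esub> h = \<one>\<^bsub>padic_int p\<^esub>"
    using padic_int_half \<open>odd p\<close> by blast
  \<comment> \<open>The second alternative is established for every \<open>M\<close>; primality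
    gives p > 0, hence the commutative ring structure.\<close>
  then show ?thesis
    using cring.mat2_sum_of_two_squares[OF cring_padic_int] prime_gt_0_nat assms by blast
qed

end
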